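(* Let $P$ be a partially ordered set and $R$ a commutative unital ring. The $R$-bilinear antisymmetric biderivations of $FI(P,R)$ are exactly the maps $B$ on $FI(P,R)\times FI(P,R)$ of the form $$B(f,g)(x,y)=\begin{cases}0, & x=y,\\ \sigma(x,y)\,[f,g](x,y), & x<y,\end{cases}$$ for all $f,g\in FI(P,R)$ and all $x\le y$ in $P$, where $\sigma:P^2_<\to R$ is a map which is constant on chains and $[f,g]=fg-gf$. (In particular, for each such $\sigma$ the values $B(f,g)$ given by this formula lie in $FI(P,R)$.)
   Context: Let $(P,\le)$ be a poset and $R$ a commutative unital ring. $I(P,R)$ is the $R$-module of formal sums $f=\sum_{x\le y}f(x,y)e_{xy}$ with $f(x,y)\in R$, where $e_{xy}$ is a symbol attached to each pair $x\le y$ in $P$. Such $f$ is a finitary series if for every $x<y$ in $P$ there are only finitely many pairs $u,v\in P$ with $x\le u<v\le y$ and $f(u,v)\ne 0$. $FI(P,R)\subseteq I(P,R)$ is the set of finitary series; it is an associative unital $R$-algebra (the finitary incidence algebra of $P$ over $R$) under $(fg)(x,y)=\sum_{x\le z\le y}f(x,z)g(z,y)$. A biderivation of an associative ring $A$ is a biadditive map $B:A\times A\to A$ with $B(ab,c)=B(a,c)b+aB(b,c)$ and $B(a,bc)=B(a,b)c+bB(a,c)$ for all $a,b,c\in A$; it is antisymmetric if $B(a,a)=0$ for all $a\in A$. $P^2_<=\{(x,y)\in P^2\mid x<y\}$. A map $\sigma:P^2_<\to R$ is constant on chains if for every chain $C\subseteq P$ and all $x<y$, $u<v$ in $C$ one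 has $\sigma(x,y)=\sigma(u,v)$. *)

theory Defs
  imports Complex_Main
begin

text \<open>
  A poset is a type of class \<open>order\<close>. A formal sum over the pairs \<open>x \<le> y\<close> is represented by its
  coefficient function, extended by zero to all pairs of elements.
\<close>

definition incidence_series :: "('p::order \<Rightarrow> 'p \<Rightarrow> 'r::comm_ring_1) set" where
  "incidence_series = {f. \<forall>x y. \<not> x \<le> y \<longrightarrow> f x y = 0}"

definition nonzero_pairs :: "('p::order \<Rightarrow> 'p \<Rightarrow> 'r::comm_ring_1) \<Rightarrow> 'p \<Rightarrow> 'p \<Rightarrow> ('p \<times> 'p) set" where
  "nonzero_pairs f x y = {(u, v). x \<le> u \<and> u < v \<and> v \<le> y \<and> f u v \<noteq> 0}"

definition finitary_series :: "('p::order \<Rightarrow> 'p \<Rightarrow> 'r::comm_ring_1) set" where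
  "finitary_series = {f \<in> incidence_series. \<forall>x y. x < y \<longrightarrow> finite (nonzero_pairs f x y)}"

text \<open>The interval from \<open>x\<close> to \<open>y\<close> may be infinite; the sum runs over its nonzero terms, which are
  finitely many for finitary series (lemma \<open>finite_convolution_support\<close> below).\<close>

definition convolution ::
  "('p::order \<Rightarrow> 'p \<Rightarrow> 'r::comm_ring_1) \<Rightarrow> ('p \<Rightarrow> 'p \<Rightarrow> 'r) \<Rightarrow> 'p \<Rightarrow> 'p \<Rightarrow> 'r" where
  "convolution f g x y = (\<Sum>z | x \<le> z \<and> z \<le> y \<and> f x z * g z y \<noteq> 0. f x z * g z y)"

lemma incidence_seriesD: "f \<in> incidence_series \<Longrightarrow> f x y \<noteq> 0 \<Longrightarrow> x \<le> y"
  unfolding incidence_series_def by auto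

lemma finitary_seriesD: "f \<in> finitary_series \<Longrightarrow> f x y \<noteq> 0 \<Longrightarrow> x \<le> y"
  unfolding finitary_series_def using incidence_seriesD by auto

lemma finite_nonzero_pairs:
  assumes "f \<in> finitary_series"
  shows "finite (nonzero_pairs f x y)"
proof (cases "x < y")
  case True
  then show ?thesis using assms unfolding finitary_series_def by auto
next
  case False
  then have "nonzero_pairs f x y = {}"
    unfolding nonzero_pairs_def by auto
  then show ?thesis by simp
qed

definition relevant_points :: "('p::order \<Rightarrow> 'p \<Rightarrow> 'r::comm_ring_1) \<Rightarrow> 'p \<Rightarrow> 'p \<Rightarrow> 'p set" where
  "relevant_points f x y =
    {x, y} \<union> fst ` nonzero_pairs f x y \<union> snd ` nonzero_pairs f x y"

lemma finite_relevant_points: "f \<in> finitary_series \<Longrightarrow> finite (relevant_points f x y)"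
  unfolding relevant_points_def by (simp add: finite_nonzero_pairs)

lemma relevant_points_memI:
  assumes "x \<le> u" "u \<le> v" "v \<le> y" "f u v \<noteq> 0"
  shows "u \<in> relevant_points f x y \<or> u = v" "v \<in> relevant_points f x y \<or> u = v"
proof -
  have "u \<noteq> v \<Longrightarrow> (u, v) \<in> nonzero_pairs f x y"
    using assms unfolding nonzero_pairs_def by auto
  then show "u \<in> relevant_points f x y \<or> u = v" "v \<in> relevant_points f x y \<or> u = v"
    unfolding relevant_points_def by force+
qed

lemma endpoints_in_relevant_points: "x \<in> relevant_points f x y" "y \<in> relevant_points f x y"
  unfolding relevant_points_def by auto

lemma convolution_support_subset:
  "{z. x \<le> z \<and> z \<le> y \<and> f x z * g z y \<noteq> 0} \<subseteq> relevant_points f x y"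
proof
  fix z assume "z \<in> {z. x \<le> z \<and> z \<le> y \<and> f x z * g z y \<noteq> 0}"
  then have "x \<le> z" "z \<le> y" "f x z \<noteq> 0" by auto
  then show "z \<in> relevant_points f x y"
    using relevant_points_memI(2)[of x x z y f] endpoints_in_relevant_points(1)[of x f y] by auto
qed

lemma finite_convolution_support:
  "f \<in> finitary_series \<Longrightarrow> finite {z. x \<le> z \<and> z \<le> y \<and> f x z * g z y \<noteq> 0}"
  using convolution_support_subset finite_relevant_points by (rule finite_subset)

lemma convolution_eq_sum:
  assumes "f \<in> finitary_series" "g \<in> finitary_series" "finite S"
    and "\<And>z. x \<le> z \<Longrightarrow> z \<le> y \<Longrightarrow> f x z \<noteq> 0 \<Longrightarrow> g z y \<noteq> 0 \<Longrightarrow> z \<in> S"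
  shows "convolution f g x y = (\<Sum>z\<in>S. f x z * g z y)"
  unfolding convolution_def
proof (rule sum.mono_neutral_left)
  show "{z. x \<le> z \<and> z \<le> y \<and> f x z * g z y \<noteq> 0} \<subseteq> S"
    using assms(4) by (auto dest: mult_not_zero)
  have "f x z * g z y = 0 \<or> (x \<le> z \<and> z \<le> y)" for z
    using finitary_seriesD[OF assms(1), of x z] finitary_seriesD[OF assms(2), of z y]
    by (auto dest: mult_not_zero)
  then show "\<forall>z\<in>S - {z. x \<le> z \<and> z \<le> y \<and> f x z * g z y \<noteq> 0}. f x z * g z y = 0"
    by auto
qed (rule assms(3))

lemma convolution_eq_sum_left:
  assumes "f \<in> finitary_series" "g \<in> finitary_series"
  shows "convolution f g x y = (\<Sum>z\<in>relevant_points f x y. f x z * g z y)"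
proof (rule convolution_eq_sum[OF assms finite_relevant_points[OF assms(1)]])
  fix z assume "x \<le> z" "z \<le> y" "f x z \<noteq> 0"
  then show "z \<in> relevant_points f x y"
    using relevant_points_memI(2)[of x x z y f] endpoints_in_relevant_points(1)[of x f y] by auto
qed

lemma convolution_eq_sum_right:
  assumes "f \<in> finitary_series" "g \<in> finitary_series"
  shows "convolution f g x y = (\<Sum>z\<in>relevant_points g x y. f x z * g z y)"
proof (rule convolution_eq_sum[OF assms finite_relevant_points[OF assms(2)]])
  fix z assume "x \<le> z" "z \<le> y" "g z y \<noteq> 0"
  then show "z \<in> relevant_points g x y"
    using relevant_points_memI(1)[of x z y y g] endpoints_in_relevant_points(2)[of y g x] by auto
qed

lemma zero_finitary: "(\<lambda>x y. 0) \<in> finitary_series"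
  unfolding finitary_series_def incidence_series_def nonzero_pairs_def by simp

lemma one_finitary:
  "(\<lambda>x y. if x = y then 1 else 0) \<in> (finitary_series :: ('p::order \<Rightarrow> 'p \<Rightarrow> 'r::comm_ring_1) set)"
proof -
  have "nonzero_pairs (\<lambda>x y. if x = y then 1 else (0::'r)) x y = {}" for x y :: 'p
    unfolding nonzero_pairs_def by auto
  then show ?thesis unfolding finitary_series_def incidence_series_def by auto
qed

lemma finitary_series_pointwise:
  assumes "f \<in> finitary_series" "g \<in> finitary_series"
    and "\<And>x y. h x y \<noteq> 0 \<Longrightarrow> f x y \<noteq> 0 \<or> g x y \<noteq> 0"
  shows "h \<in> finitary_series"
proof -
  have "nonzero_pairs h x y \<subseteq> nonzero_pairs f x y \<union> nonzero_pairs g x y" for x y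
    using assms(3) unfolding nonzero_pairs_def by auto
  moreover have "finite (nonzero_pairs f x y \<union> nonzero_pairs g x y)" for x y
    using assms(1,2) by (simp add: finite_nonzero_pairs)
  ultimately have "finite (nonzero_pairs h x y)" for x y
    by (meson finite_subset)
  moreover have "h \<in> incidence_series"
    using assms(3) finitary_seriesD[OF assms(1)] finitary_seriesD[OF assms(2)]
    unfolding incidence_series_def by blast
  ultimately show ?thesis unfolding finitary_series_def by auto
qed

lemma convolution_nonzeroE:
  assumes "convolution f g x y \<noteq> 0"
  obtains z where "x \<le> z" "z \<le> y" "f x z \<noteq> 0" "g z y \<noteq> 0"
proof -
  have "\<exists>z\<in>{z. x \<le> z \<and> z \<le> y \<and> f x z * g z y \<noteq> 0}. f x z * g z y \<noteq> 0"
    using assms unfolding convolution_def by (meson sum.neutral)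
  then show ?thesis using that by (auto dest: mult_not_zero)
qed

lemma convolution_finitary:
  assumes f: "f \<in> finitary_series" and g: "g \<in> finitary_series"
  shows "convolution f g \<in> finitary_series"
proof -
  have "nonzero_pairs (convolution f g) x y \<subseteq> nonzero_pairs f x y \<union> nonzero_pairs g x y
      \<union> (\<lambda>(p, q). (fst p, snd q)) ` (nonzero_pairs f x y \<times> nonzero_pairs g x y)"
    (is "_ \<subseteq> ?A") for x y
  proof
    fix p assume p: "p \<in> nonzero_pairs (convolution f g) x y"
    obtain u v where uv: "p = (u, v)" by (cases p)
    have *: "x \<le> u" "u < v" "v \<le> y" "convolution f g u v \<noteq> 0"
      using p uv unfolding nonzero_pairs_def by auto
    from *(4) obtain z where z: "u \<le> z" "z \<le> v" "f u z \<noteq> 0" "g z v \<noteq> 0"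
      by (rule convolution_nonzeroE)
    have zx: "x \<le> z" "z \<le> y" using *(1,3) z(1,2) by auto
    consider "u = z" | "z = v" | "u < z" "z < v"
      using z(1,2) by (auto simp: order.order_iff_strict)
    then show "p \<in> ?A"
    proof cases
      case 1
      then have "p \<in> nonzero_pairs g x y" using * z uv unfolding nonzero_pairs_def by auto
      then show ?thesis by simp
    next
      case 2
      then have "p \<in> nonzero_pairs f x y" using * z uv unfolding nonzero_pairs_def by auto
      then show ?thesis by simp
    next
      case 3
      then have "(u, z) \<in> nonzero_pairs f x y" "(z, v) \<in> nonzero_pairs g x y"
        using * z zx unfolding nonzero_pairs_def by auto
      then show ?thesis using uv by force
    qed
  qed
  moreover have "finite (nonzero_pairs f x y \<union> nonzero_pairs g x y
      \<union> (\<lambda>(p, q). (fst p, snd q)) ` (nonzero_pairs f x y \<times> nonzero_pairs g x y))" for x y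
    using f g by (simp add: finite_nonzero_pairs)
  ultimately have "finite (nonzero_pairs (convolution f g) x y)" for x y
    by (meson finite_subset)
  moreover have "convolution f g \<in> incidence_series"
  proof -
    have "x \<le> y" if nz: "convolution f g x y \<noteq> 0" for x y
    proof -
      obtain z where "x \<le> z" "z \<le> y" using convolution_nonzeroE[OF nz] .
      then show ?thesis by (rule order.trans)
    qed
    then show ?thesis unfolding incidence_series_def by blast
  qed
  ultimately show ?thesis unfolding finitary_series_def by auto
qed

lemma convolution_assoc:
  assumes f: "f \<in> finitary_series" and g: "g \<in> finitary_series" and h: "h \<in> finitary_series"
  shows "convolution (convolution f g) h x y = convolution f (convolution g h) x y"
proof -
  define S where "S = relevant_points f x y \<union> relevant_points g x y \<union> relevant_points h x y"
  have fS: "finite S" unfolding S_def using f g h by (simp add: finite_relevant_points)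
  have xy: "x \<in> S" "y \<in> S" unfolding S_def using endpoints_in_relevant_points by auto
  have Sf: "w \<in> S" if "x \<le> w" "w \<le> y" "f x w \<noteq> 0" for w
    using relevant_points_memI(2)[of x x w y f] that xy unfolding S_def by auto
  have Sh: "w \<in> S" if "x \<le> w" "w \<le> y" "h w y \<noteq> 0" for w
    using relevant_points_memI(1)[of x w y y h] that xy unfolding S_def by auto
  have L: "convolution f g x z * h z y = (\<Sum>w\<in>S. f x w * g w z) * h z y" for z
  proof (cases "h z y = 0")
    case False
    then have "z \<le> y" using finitary_seriesD[OF h] by auto
    then have "convolution f g x z = (\<Sum>w\<in>S. f x w * g w z)"
      by (intro convolution_eq_sum f g fS Sf) auto
    then show ?thesis by simp
  qed simp
  have R: "f x w * convolution g h w y = f x w * (\<Sum>z\<in>S. g w z * h z y)" for w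
  proof (cases "f x w = 0")
    case False
    then have "x \<le> w" using finitary_seriesD[OF f] by auto
    then have "convolution g h w y = (\<Sum>z\<in>S. g w z * h z y)"
      by (intro convolution_eq_sum g h fS Sh) auto
    then show ?thesis by simp
  qed simp
  have "convolution (convolution f g) h x y = (\<Sum>z\<in>S. convolution f g x z * h z y)"
    by (intro convolution_eq_sum convolution_finitary f g h fS Sh) auto
  also have "\<dots> = (\<Sum>z\<in>S. \<Sum>w\<in>S. f x w * g w z * h z y)"
    by (simp add: L sum_distrib_right)
  also have "\<dots> = (\<Sum>w\<in>S. \<Sum>z\<in>S. f x w * g w z * h z y)"
    by (rule sum.swap)
  also have "\<dots> = (\<Sum>w\<in>S. f x w * convolution g h w y)"
    by (simp add: R sum_distrib_left mult.assoc)
  also have "\<dots> = convolution f (convolution g h) x y"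
    by (rule convolution_eq_sum[symmetric]) (auto intro: convolution_finitary f g h fS Sf)
  finally show ?thesis .
qed

typedef (overloaded) ('p, 'r) fi = "finitary_series :: ('p::order \<Rightarrow> 'p \<Rightarrow> 'r::comm_ring_1) set"
  morphisms fi_coeff Abs_fi
  using zero_finitary by blast

setup_lifting type_definition_fi

lemma fi_eqI: "(\<And>x y. fi_coeff f x y = fi_coeff g x y) \<Longrightarrow> f = g"
  by (simp add: fi_coeff_inject[symmetric] fun_eq_iff)

lemma fi_coeff_nonzero_le: "fi_coeff f x y \<noteq> 0 \<Longrightarrow> x \<le> y"
  using finitary_seriesD[OF fi_coeff] .

instantiation fi :: (order, comm_ring_1) ring_1
begin

lift_definition zero_fi :: "('a, 'b) fi" is "\<lambda>x y. 0"
  by (rule zero_finitary)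

lift_definition one_fi :: "('a, 'b) fi" is "\<lambda>x y. if x = y then 1 else 0"
  by (rule one_finitary)

lift_definition plus_fi :: "('a, 'b) fi \<Rightarrow> ('a, 'b) fi \<Rightarrow> ('a, 'b) fi" is "\<lambda>f g x y. f x y + g x y"
  by (erule (1) finitary_series_pointwise) auto

lift_definition minus_fi :: "('a, 'b) fi \<Rightarrow> ('a, 'b) fi \<Rightarrow> ('a, 'b) fi" is "\<lambda>f g x y. f x y - g x y"
  by (erule (1) finitary_series_pointwise) auto

lift_definition uminus_fi :: "('a, 'b) fi \<Rightarrow> ('a, 'b) fi" is "\<lambda>f x y. - f x y"
  by (erule finitary_series_pointwise[OF _ zero_finitary]) auto

lift_definition times_fi :: "('a, 'b) fi \<Rightarrow> ('a, 'b) fi \<Rightarrow> ('a, 'b) fi" is convolution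
  by (rule convolution_finitary)

instance
proof
  fix f g h :: "('a, 'b) fi"
  show "f + g + h = f + (g + h)" by transfer (simp add: add.assoc)
  show "f + g = g + f" by transfer (simp add: add.commute)
  show "0 + f = f" by transfer simp
  show "- f + f = 0" by transfer simp
  show "f - g = f + - g" by transfer simp
  show "f * g * h = f * (g * h)"
    by transfer (simp add: convolution_assoc fun_eq_iff)
  have one_left: "convolution (\<lambda>x y. if x = y then 1 else 0) k x y = k x y"
    if k: "k \<in> finitary_series" for k :: "'a \<Rightarrow> 'a \<Rightarrow> 'b" and x y
    by (subst convolution_eq_sum[OF one_finitary k, of "{x}"]) (auto split: if_splits)
  show "1 * f = f"
    by transfer (auto simp: one_left fun_eq_iff)
  have one_right: "convolution k (\<lambda>x y. if x = y then 1 else 0) x y = k x y"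
    if k: "k \<in> finitary_series" for k :: "'a \<Rightarrow> 'a \<Rightarrow> 'b" and x y
    by (subst convolution_eq_sum[OF k one_finitary, of "{y}"]) (auto split: if_splits)
  show "f * 1 = f"
    by transfer (auto simp: one_right fun_eq_iff)
  have plus_fin: "(\<lambda>x y. p x y + q x y) \<in> finitary_series"
    if "p \<in> finitary_series" "q \<in> finitary_series" for p q :: "'a \<Rightarrow> 'a \<Rightarrow> 'b"
    by (rule finitary_series_pointwise[OF that]) auto
  have dl: "convolution (\<lambda>x y. p x y + q x y) r x y = convolution p r x y + convolution q r x y"
    if p: "p \<in> finitary_series" and q: "q \<in> finitary_series" and r: "r \<in> finitary_series"
    for p q r :: "'a \<Rightarrow> 'a \<Rightarrow> 'b" and x y
    by (simp add: convolution_eq_sum_right[OF plus_fin[OF p q] r] convolution_eq_sum_right[OF p r]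
        convolution_eq_sum_right[OF q r] distrib_right sum.distrib)
  show "(f + g) * h = f * h + g * h"
    by transfer (simp add: dl fun_eq_iff)
  have dr: "convolution r (\<lambda>x y. p x y + q x y) x y = convolution r p x y + convolution r q x y"
    if p: "p \<in> finitary_series" and q: "q \<in> finitary_series" and r: "r \<in> finitary_series"
    for p q r :: "'a \<Rightarrow> 'a \<Rightarrow> 'b" and x y
    by (simp add: convolution_eq_sum_left[OF r plus_fin[OF p q]] convolution_eq_sum_left[OF r p]
        convolution_eq_sum_left[OF r q] distrib_left sum.distrib)
  show "f * (g + h) = f * g + f * h"
    by transfer (simp add: dr fun_eq_iff)
  show "(0 :: ('a, 'b) fi) \<noteq> 1"
    by transfer (metis zero_neq_one)
qed

end

lift_definition scale_fi :: "'r \<Rightarrow> ('p::order, 'r::comm_ring_1) fi \<Rightarrow> ('p, 'r) fi"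
  is "\<lambda>r f x y. r * f x y"
  by (erule finitary_series_pointwise[OF _ zero_finitary]) auto

lemma fi_coeff_times:
  "fi_coeff (f * g) x y
    = (\<Sum>z | x \<le> z \<and> z \<le> y \<and> fi_coeff f x z * fi_coeff g z y \<noteq> 0. fi_coeff f x z * fi_coeff g z y)"
  by (simp add: times_fi.rep_eq convolution_def)

lemma module_scale_fi: "module scale_fi"
  by standard (transfer, simp add: algebra_simps)+

definition biderivation :: "('a::ring \<Rightarrow> 'a \<Rightarrow> 'a) \<Rightarrow> bool" where
  "biderivation B \<longleftrightarrow>
    (\<forall>a b c. B (a + b) c = B a c + B b c) \<and>
    (\<forall>a b c. B a (b + c) = B a b + B a c) \<and>
    (\<forall>a b c. B (a * b) c = B a c * b + a * B b c) \<and>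
    (\<forall>a b c. B a (b * c) = B a b * c + b * B a c)"

definition antisymmetric_biderivation :: "('a::ring \<Rightarrow> 'a \<Rightarrow> 'a) \<Rightarrow> bool" where
  "antisymmetric_biderivation B \<longleftrightarrow> biderivation B \<and> (\<forall>a. B a a = 0)"

definition fi_bilinear ::
  "(('p::order, 'r::comm_ring_1) fi \<Rightarrow> ('p, 'r) fi \<Rightarrow> ('p, 'r) fi) \<Rightarrow> bool" where
  "fi_bilinear B \<longleftrightarrow>
    (\<forall>f. module_hom scale_fi scale_fi (B f)) \<and>
    (\<forall>g. module_hom scale_fi scale_fi (\<lambda>f. B f g))"

text \<open>A map on the pairs \<open>x < y\<close> is a total binary function of which only the values at such pairs
  are ever used.\<close>

definition constant_on_chains :: "('p::order \<Rightarrow> 'p \<Rightarrow> 'r) \<Rightarrow> bool" where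
  "constant_on_chains \<sigma> \<longleftrightarrow>
    (\<forall>C. Complete_Partial_Order.chain (\<le>) C \<longrightarrow>
      (\<forall>x\<in>C. \<forall>y\<in>C. \<forall>u\<in>C. \<forall>v\<in>C. x < y \<longrightarrow> u < v \<longrightarrow> \<sigma> x y = \<sigma> u v))"

end

theory Submission
  imports Defs
begin

text \<open>Let \<open>e\<^bsub>xy\<^esub>\<close> be the matrix units. Applying an \<open>R\<close>-linear derivation \<open>d\<close> to
  \<open>e\<^bsub>xx\<^esub> f e\<^bsub>yy\<^esub> = f(x,y) e\<^bsub>xy\<^esub>\<close> expresses \<open>d(f)(x,y)\<close> through the values of \<open>d\<close> at the three units
  \<open>e\<^bsub>xy\<^esub>\<close>, \<open>e\<^bsub>xx\<^esub>\<close>, \<open>e\<^bsub>yy\<^esub>\<close>. Doing this in both arguments of \<open>B\<close>, where antisymmetry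
  forces \<open>B(e\<^bsub>xx\<^esub>, e\<^bsub>yy\<^esub>) = 0\<close>, determines \<open>B\<close> by \<open>\<sigma>(x,y) = B(e\<^bsub>xx\<^esub>, e\<^bsub>xy\<^esub>)(x,y)\<close>.
  The factorisation \<open>e\<^bsub>xz\<^esub> = e\<^bsub>xy\<^esub> e\<^bsub>yz\<^esub>\<close> makes \<open>\<sigma>\<close> constant on chains, so that it can be
  pulled out of the convolutions.\<close>

subsection \<open>Coefficients and matrix units\<close>

lemmas fi_coeff_simps [simp] =
  zero_fi.rep_eq plus_fi.rep_eq minus_fi.rep_eq uminus_fi.rep_eq scale_fi.rep_eq

lemma fi_coeff_not_le: "\<not> x \<le> y \<Longrightarrow> fi_coeff f x y = 0"
  using fi_coeff_nonzero_le by blast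

lemma fi_coeff_times_sum:
  assumes "finite S" "\<And>z. fi_coeff f x z \<noteq> 0 \<Longrightarrow> fi_coeff g z y \<noteq> 0 \<Longrightarrow> z \<in> S"
  shows "fi_coeff (f * g) x y = (\<Sum>z\<in>S. fi_coeff f x z * fi_coeff g z y)"
  unfolding times_fi.rep_eq
  by (rule convolution_eq_sum) (use assms fi_coeff in auto)

text \<open>Made for factors whose entries are multiples of another series by scalars varying with
  \<open>z\<close>: at a fixed \<open>(x, y)\<close> the factor can be exchanged for one global
  scalar multiple.\<close>

lemma fi_coeff_times_cong:
  assumes "\<And>z. x \<le> z \<Longrightarrow> z \<le> y \<Longrightarrow>
    fi_coeff f x z * fi_coeff g z y = fi_coeff f' x z * fi_coeff g' z y"
  shows "fi_coeff (f * g) x y = fi_coeff (f' * g') x y"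
  unfolding fi_coeff_times using assms by (intro sum.cong) auto

lemma fi_coeff_times_diag [simp]: "fi_coeff (f * g) x x = fi_coeff f x x * fi_coeff g x x"
  by (subst fi_coeff_times_sum[of "{x}"]) (auto dest!: fi_coeff_nonzero_le)

lemma scale_fi_times_left: "scale_fi r f * g = scale_fi r (f * g)"
proof (rule fi_eqI)
  fix x y
  \<comment> \<open>The nonzero terms of the product may change with \<open>r\<close>, as
    \<open>r\<close> may be a zero divisor; this index set depends on \<open>g\<close>
    alone.\<close>
  let ?S = "relevant_points (fi_coeff g) x y"
  have "fi_coeff (h * g) x y = (\<Sum>z\<in>?S. fi_coeff h x z * fi_coeff g z y)" for h
    unfolding times_fi.rep_eq by (rule convolution_eq_sum_right) (rule fi_coeff)+
  then show "fi_coeff (scale_fi r f * g) x y = fi_coeff (scale_fi r (f * g)) x y"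
    by (simp add: sum_distrib_left mult.assoc)
qed

lemma scale_fi_times_right: "f * scale_fi r g = scale_fi r (f * g)"
proof -
  have "fi_coeff (f * scale_fi r g) x y = fi_coeff (scale_fi r f * g) x y" for x y
    by (rule fi_coeff_times_cong) (simp add: mult_ac)
  then show ?thesis by (simp add: fi_eqI flip: scale_fi_times_left)
qed

text \<open>The junk value of \<open>matrix_unit x y\<close> is \<open>0\<close> when \<open>x \<le> y\<close> fails.\<close>

lift_definition matrix_unit :: "'p \<Rightarrow> 'p \<Rightarrow> ('p::order, 'r::comm_ring_1) fi"
  is "\<lambda>x y u v. if x \<le> y \<and> u = x \<and> v = y then 1 else 0"
proof -
  fix x y :: 'p
  let ?e = "\<lambda>u v. if x \<le> y \<and> u = x \<and> v = y then 1 else (0::'r)"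
  have "nonzero_pairs ?e a b \<subseteq> {(x, y)}" for a b
    unfolding nonzero_pairs_def by auto
  then have "finite (nonzero_pairs ?e a b)" for a b
    by (rule finite_subset) simp
  then show "?e \<in> finitary_series"
    unfolding finitary_series_def incidence_series_def by auto
qed

declare matrix_unit.rep_eq [simp]

lemma fi_coeff_matrix_unit_times [simp]:
  "fi_coeff (matrix_unit x y * f) u v = (if x \<le> y \<and> u = x then fi_coeff f y v else 0)"
  by (subst fi_coeff_times_sum[of "{y}"]) (auto split: if_splits)

lemma fi_coeff_times_matrix_unit [simp]:
  "fi_coeff (f * matrix_unit x y) u v = (if x \<le> y \<and> v = y then fi_coeff f u x else 0)"
  by (subst fi_coeff_times_sum[of "{x}"]) (auto split: if_splits)

lemma matrix_unit_times:
  "x \<le> y \<Longrightarrow> y \<le> z \<Longrightarrow> matrix_unit x y * matrix_unit y z = matrix_unit x z"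
  by (rule fi_eqI) auto

lemma matrix_unit_times_eq_0: "y \<noteq> y' \<Longrightarrow> matrix_unit x y * matrix_unit y' z = 0"
  by (rule fi_eqI) auto

lemma matrix_unit_corner:
  "x \<le> y \<Longrightarrow> matrix_unit x x * f * matrix_unit y y = scale_fi (fi_coeff f x y) (matrix_unit x y)"
  by (rule fi_eqI) auto

subsection \<open>Linear derivations\<close>

locale fi_derivation =
  fixes d :: "('p::order, 'r::comm_ring_1) fi \<Rightarrow> ('p, 'r) fi"
  assumes scale: "d (scale_fi r f) = scale_fi r (d f)"
    and leibniz: "d (f * g) = d f * g + f * d g"
begin

lemma zero: "d 0 = 0"
  using leibniz[of 0 0] by simp

text \<open>Compare entries in d(e) = d(e) e + e d(e) for the idempotent e = e_xx: away from row and
  column \<open>x\<close> the right side is 0, and at \<open>(x, x)\<close> it is twice the left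
  side.\<close>

lemma coeff_diag_unit:
  assumes "u = x \<longleftrightarrow> v = x"
  shows "fi_coeff (d (matrix_unit x x)) u v = 0"
proof -
  have "d (matrix_unit x x) = d (matrix_unit x x) * matrix_unit x x + matrix_unit x x * d (matrix_unit x x)"
    by (simp add: matrix_unit_times flip: leibniz)
  then have "fi_coeff (d (matrix_unit x x)) u v =
      fi_coeff (d (matrix_unit x x) * matrix_unit x x + matrix_unit x x * d (matrix_unit x x)) u v"
    by simp
  then show ?thesis using assms by (auto split: if_splits)
qed

lemma coeff_diag_unit_swap:
  assumes "x \<noteq> y"
  shows "fi_coeff (d (matrix_unit y y)) x y = - fi_coeff (d (matrix_unit x x)) x y"
proof -
  have "0 = fi_coeff (d (matrix_unit x x * matrix_unit y y)) x y"
    using assms by (simp add: matrix_unit_times_eq_0 zero)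
  also have "\<dots> = fi_coeff (d (matrix_unit x x)) x y + fi_coeff (d (matrix_unit y y)) x y"
    by (simp add: leibniz)
  finally show ?thesis by (simp add: eq_neg_iff_add_eq_0 add.commute)
qed

text \<open>A series need not be a finite combination of matrix units; cutting out one corner still
  recovers each entry of \<open>d f\<close> from values of \<open>d\<close> at units.\<close>

lemma coeff_corner:
  assumes "x \<le> y"
  shows "fi_coeff (d f) x y = fi_coeff f x y * fi_coeff (d (matrix_unit x y)) x y
    - fi_coeff (d (matrix_unit x x) * f) x y - fi_coeff (f * d (matrix_unit y y)) x y"
proof -
  have "scale_fi (fi_coeff f x y) (d (matrix_unit x y)) =
      (d (matrix_unit x x) * f + matrix_unit x x * d f) * matrix_unit y y
      + matrix_unit x x * f * d (matrix_unit y y)"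
    by (simp add: assms leibniz flip: matrix_unit_corner scale)
  then have "fi_coeff (scale_fi (fi_coeff f x y) (d (matrix_unit x y))) x y =
      fi_coeff ((d (matrix_unit x x) * f + matrix_unit x x * d f) * matrix_unit y y
      + matrix_unit x x * f * d (matrix_unit y y)) x y"
    by (rule arg_cong)
  then show ?thesis
    using assms by (simp add: distrib_right mult.assoc[of "matrix_unit x x"] eq_diff_eq add_ac)
qed

lemma coeff_diag: "fi_coeff (d f) x x = 0"
  by (subst coeff_corner) (simp_all add: coeff_diag_unit)

end

subsection \<open>Antisymmetric biderivations\<close>

locale fi_biderivation =
  fixes B :: "('p::order, 'r::comm_ring_1) fi \<Rightarrow> ('p, 'r) fi \<Rightarrow> ('p, 'r) fi"
  assumes bilinear: "fi_bilinear B"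
    and antisymmetric: "antisymmetric_biderivation B"
begin

lemma alternating [simp]: "B f f = 0"
  using antisymmetric unfolding antisymmetric_biderivation_def by blast

lemma antisym: "B f g = - B g f"
proof -
  have "B (a + b) c = B a c + B b c" "B a (b + c) = B a b + B a c" for a b c
    using antisymmetric unfolding antisymmetric_biderivation_def biderivation_def by auto
  \<comment> \<open>Polarisation; \<open>alternating\<close> is held back because it would collapse
    the left side before additivity expands it.\<close>
  then have "B (f + g) (f + g) = B f g + B g f"
    by (simp del: alternating) simp
  then show ?thesis by (simp add: eq_neg_iff_add_eq_0)
qed

sublocale right: fi_derivation "B f" for f
  using bilinear antisymmetric
  unfolding fi_bilinear_def antisymmetric_biderivation_def biderivation_def
  by unfold_locales (auto simp: module_hom_iff)

sublocale left: fi_derivation "\<lambda>f. B f g" for g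
  using bilinear antisymmetric
  unfolding fi_bilinear_def antisymmetric_biderivation_def biderivation_def
  by unfold_locales (auto simp: module_hom_iff)

text \<open>For \<open>x < y\<close> this is the eigenvalue of \<open>B (matrix_unit x x)\<close> at
  \<open>matrix_unit x y\<close>, see \<open>diag_unit_matrix_unit\<close>.\<close>

definition \<sigma> :: "'p \<Rightarrow> 'p \<Rightarrow> 'r" where
  "\<sigma> x y = fi_coeff (B (matrix_unit x x) (matrix_unit x y)) x y"

text \<open>Since B(e_xx, e_xx) = 0, applying B(e_xx, -) to e_xx e_yy = 0 = e_yy e_xx kills row and
  column \<open>x\<close>. The other entries vanish because the left argument is the idempotent
  e_xx.\<close>

lemma diag_units: "B (matrix_unit x x) (matrix_unit y y) = 0"
proof (cases "x = y")
  case False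
  let ?b = "B (matrix_unit x x) (matrix_unit y y)"
  have "B (matrix_unit x x) (matrix_unit x x * matrix_unit y y) = 0"
    "B (matrix_unit x x) (matrix_unit y y * matrix_unit x x) = 0"
    using False by (simp_all add: matrix_unit_times_eq_0 right.zero)
  then have "matrix_unit x x * ?b = 0" "?b * matrix_unit x x = 0"
    by (simp_all add: right.leibniz)
  then have "fi_coeff (matrix_unit x x * ?b) x v = 0" "fi_coeff (?b * matrix_unit x x) u x = 0" for u v
    by simp_all
  then have "fi_coeff ?b x v = 0" "fi_coeff ?b u x = 0" for u v
    by simp_all
  moreover have "fi_coeff ?b u v = 0" if "u \<noteq> x" "v \<noteq> x" for u v
    using that by (intro left.coeff_diag_unit) simp
  ultimately show ?thesis by (intro fi_eqI) (metis zero_fi.rep_eq)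
qed simp

text \<open>By \<open>diag_units\<close> both correction terms of \<open>right.coeff_corner\<close>
  vanish, so B(e_ww, -) multiplies each entry by a scalar.\<close>

lemma coeff_diag_unit_left:
  assumes "x < y"
  shows "fi_coeff (B (matrix_unit w w) f) x y =
    (if w = x then \<sigma> x y else if w = y then - \<sigma> x y else 0) * fi_coeff f x y"
proof -
  have "fi_coeff (B (matrix_unit w w) (matrix_unit x y)) x y =
      (if w = x then \<sigma> x y else if w = y then - \<sigma> x y else 0)"
    using assms left.coeff_diag_unit_swap[of x y "matrix_unit x y"]
    by (auto simp: \<sigma>_def left.coeff_diag_unit)
  then show ?thesis
    using assms right.coeff_corner[of x y "matrix_unit w w" f] by (simp add: diag_units)
qed

lemma diag_unit_matrix_unit:
  assumes "x < y"
  shows "B (matrix_unit w w) (matrix_unit x y) =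
    scale_fi (if w = x then \<sigma> x y else if w = y then - \<sigma> x y else 0) (matrix_unit x y)"
proof (rule fi_eqI)
  fix u v :: 'p
  consider "u < v" | "u = v" | "\<not> u \<le> v" by (auto simp: order.order_iff_strict)
  then show "fi_coeff (B (matrix_unit w w) (matrix_unit x y)) u v = fi_coeff (scale_fi
      (if w = x then \<sigma> x y else if w = y then - \<sigma> x y else 0) (matrix_unit x y)) u v"
  proof cases
    case 1
    then show ?thesis by (auto simp: coeff_diag_unit_left)
  next
    case 2
    then show ?thesis using assms by (auto simp: right.coeff_diag)
  next
    case 3
    then show ?thesis by (metis fi_coeff_not_le)
  qed
qed

text \<open>Under B(e_ww, -) the eigenvalues of e_xy and e_yz add up to that of e_xz. Taking
  \<open>w = x\<close> leaves only the first summand, \<open>w = z\<close> only the second.\<close>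

lemma \<sigma>_trans:
  assumes "x < y" "y < z"
  shows "\<sigma> x y = \<sigma> x z" "\<sigma> y z = \<sigma> x z"
proof -
  have xz: "x < z" using assms by order
  have "fi_coeff (B (matrix_unit w w) (matrix_unit x z)) x z =
      fi_coeff (B (matrix_unit w w) (matrix_unit x y)) x y +
      fi_coeff (B (matrix_unit w w) (matrix_unit y z)) y z" for w
  proof -
    have "B (matrix_unit w w) (matrix_unit x z) =
        B (matrix_unit w w) (matrix_unit x y * matrix_unit y z)"
      using assms by (simp add: matrix_unit_times)
    then show ?thesis using assms by (simp add: right.leibniz less_imp_le)
  qed
  from this[of x] this[of z] show "\<sigma> x y = \<sigma> x z" "\<sigma> y z = \<sigma> x z"
    using assms xz by (auto simp: coeff_diag_unit_left less_imp_le split: if_splits)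
qed

text \<open>By symmetry let \<open>x \<le> u\<close>; the pairs \<open>(x, y)\<close> and
  \<open>(u, v)\<close> are then linked through \<open>(x, v)\<close>, which shares its start with
  the one and its end with the other.\<close>

lemma constant_on_chains_\<sigma>: "constant_on_chains \<sigma>"
proof -
  have same_start: "\<sigma> x y = \<sigma> x v" if "x < y" "x < v" "y \<le> v \<or> v \<le> y" for x y v
    using that \<sigma>_trans(1)[of x y v] \<sigma>_trans(1)[of x v y] by (auto simp: order.order_iff_strict)
  have ordered: "\<sigma> x y = \<sigma> u v" if "x < y" "u < v" "x \<le> u" "y \<le> v \<or> v \<le> y" for x y u v
  proof -
    have "\<sigma> u v = \<sigma> x v"
      using that \<sigma>_trans(2)[of x u v] by (auto simp: order.order_iff_strict)
    moreover have "x < v" using that by order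
    ultimately show ?thesis using same_start that by metis
  qed
  show ?thesis
    unfolding constant_on_chains_def Complete_Partial_Order.chain_def
    by (metis ordered)
qed

lemma coeff_eq_\<sigma>_commutator:
  assumes "x < y"
  shows "fi_coeff (B f g) x y = \<sigma> x y * fi_coeff (f * g - g * f) x y"
proof -
  have "fi_coeff (B f (matrix_unit x y)) x y = \<sigma> x y * (fi_coeff f x x - fi_coeff f y y)"
    using assms left.coeff_corner[OF less_imp_le[OF assms], of f "matrix_unit x y"]
    by (simp add: diag_unit_matrix_unit scale_fi_times_left scale_fi_times_right algebra_simps
        split: if_splits)
  \<comment> \<open>In row \<open>x\<close> of the interval, B(f, e_xx) is
    \<open>- \<sigma> x y\<close> times \<open>f\<close> off the diagonal and 0 on it; subtracting
    the scalar \<open>fi_coeff f x x\<close> produces that 0. Column \<open>y\<close> is treated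
    likewise below, and the two scalars cancel against the e_xy term.\<close>
  moreover have "fi_coeff (B f (matrix_unit x x) * g) x y =
      fi_coeff (scale_fi (- \<sigma> x y) (f - scale_fi (fi_coeff f x x) 1) * g) x y"
  proof (rule fi_coeff_times_cong)
    fix z assume z: "x \<le> z" "z \<le> y"
    show "fi_coeff (B f (matrix_unit x x)) x z * fi_coeff g z y =
      fi_coeff (scale_fi (- \<sigma> x y) (f - scale_fi (fi_coeff f x x) 1)) x z * fi_coeff g z y"
    proof (cases "x = z")
      case True
      then show ?thesis by (simp add: right.coeff_diag left.coeff_diag one_fi.rep_eq)
    next
      case False
      then have "x < z" using z by simp
      moreover from this have "\<sigma> x z = \<sigma> x y"
        using z \<sigma>_trans(1)[of x z y] by (auto simp: order.order_iff_strict)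
      ultimately show ?thesis
        by (auto simp: antisym[of f] coeff_diag_unit_left one_fi.rep_eq)
    qed
  qed
  moreover have "fi_coeff (g * B f (matrix_unit y y)) x y =
      fi_coeff (g * scale_fi (\<sigma> x y) (f - scale_fi (fi_coeff f y y) 1)) x y"
  proof (rule fi_coeff_times_cong)
    fix z assume z: "x \<le> z" "z \<le> y"
    show "fi_coeff g x z * fi_coeff (B f (matrix_unit y y)) z y =
      fi_coeff g x z * fi_coeff (scale_fi (\<sigma> x y) (f - scale_fi (fi_coeff f y y) 1)) z y"
    proof (cases "z = y")
      case True
      then show ?thesis by (simp add: right.coeff_diag left.coeff_diag one_fi.rep_eq)
    next
      case False
      then have "z < y" using z by simp
      moreover from this have "\<sigma> z y = \<sigma> x y"
        using z \<sigma>_trans(2)[of x z y] by (auto simp: order.order_iff_strict)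
      ultimately show ?thesis
        by (auto simp: antisym[of f] coeff_diag_unit_left one_fi.rep_eq)
    qed
  qed
  ultimately show ?thesis
    using assms right.coeff_corner[of x y f g]
    by (simp add: scale_fi_times_left scale_fi_times_right left_diff_distrib right_diff_distrib
        one_fi.rep_eq)
qed

end

subsection \<open>The biderivation of a map constant on chains\<close>

locale chain_constant_bracket =
  fixes \<sigma> :: "'p::order \<Rightarrow> 'p \<Rightarrow> 'r::comm_ring_1"
    and B :: "('p, 'r) fi \<Rightarrow> ('p, 'r) fi \<Rightarrow> ('p, 'r) fi"
  assumes chain_const: "constant_on_chains \<sigma>"
    and coeff_le: "x \<le> y \<Longrightarrow>
      fi_coeff (B f g) x y = (if x = y then 0 else \<sigma> x y * fi_coeff (f * g - g * f) x y)"
begin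

text \<open>The case distinction disappears because commutators have zero diagonal, \<open>R\<close>
  being commutative.\<close>

lemma coeff: "fi_coeff (B f g) x y = \<sigma> x y * fi_coeff (f * g - g * f) x y"
  by (cases "x \<le> y") (auto simp: coeff_le fi_coeff_not_le mult.commute)

lemma \<sigma>_trans:
  assumes "x < y" "y < z"
  shows "\<sigma> x y = \<sigma> x z" "\<sigma> y z = \<sigma> x z"
proof -
  have "Complete_Partial_Order.chain (\<le>) {x, y, z}"
    using assms unfolding Complete_Partial_Order.chain_def by auto
  moreover have "x < z" using assms by order
  ultimately show "\<sigma> x y = \<sigma> x z" "\<sigma> y z = \<sigma> x z"
    using chain_const assms unfolding constant_on_chains_def by (meson insertI1 insertI2)+
qed

lemma coeff_times_right: "fi_coeff (B f g * h) x y = \<sigma> x y * fi_coeff ((f * g - g * f) * h) x y"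
proof -
  have "fi_coeff (B f g * h) x y = fi_coeff (scale_fi (\<sigma> x y) (f * g - g * f) * h) x y"
  proof (rule fi_coeff_times_cong)
    fix z assume z: "x \<le> z" "z \<le> y"
    \<comment> \<open>At \<open>z = x\<close> the value \<open>\<sigma> x x\<close> is arbitrary,
      but it multiplies a zero diagonal entry.\<close>
    then have "\<sigma> x z = \<sigma> x y \<or> x = z"
      using \<sigma>_trans(1)[of x z y] by (auto simp: order.order_iff_strict)
    then show "fi_coeff (B f g) x z * fi_coeff h z y =
        fi_coeff (scale_fi (\<sigma> x y) (f * g - g * f)) x z * fi_coeff h z y"
      by (auto simp: coeff mult.commute)
  qed
  then show ?thesis by (simp add: scale_fi_times_left)
qed

lemma coeff_times_left: "fi_coeff (h * B f g) x y = \<sigma> x y * fi_coeff (h * (f * g - g * f)) x y"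
proof -
  have "fi_coeff (h * B f g) x y = fi_coeff (h * scale_fi (\<sigma> x y) (f * g - g * f)) x y"
  proof (rule fi_coeff_times_cong)
    fix z assume z: "x \<le> z" "z \<le> y"
    then have "\<sigma> z y = \<sigma> x y \<or> z = y"
      using \<sigma>_trans(2)[of x z y] by (auto simp: order.order_iff_strict)
    then show "fi_coeff h x z * fi_coeff (B f g) z y =
        fi_coeff h x z * fi_coeff (scale_fi (\<sigma> x y) (f * g - g * f)) z y"
      by (auto simp: coeff mult.commute)
  qed
  then show ?thesis by (simp add: scale_fi_times_right)
qed

text \<open>At each entry \<open>(x, y)\<close>, every identity is \<open>\<sigma> x y\<close> times
  the same identity for the commutator.\<close>

lemma antisymmetric_biderivation: "antisymmetric_biderivation B"
  unfolding antisymmetric_biderivation_def biderivation_def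
proof (intro conjI allI)
  fix a b c
  show "B (a + b) c = B a c + B b c" "B a (b + c) = B a b + B a c" "B a a = 0"
    by (rule fi_eqI, simp add: coeff algebra_simps)+
  show "B (a * b) c = B a c * b + a * B b c"
    by (rule fi_eqI)
      (simp add: coeff_times_left coeff_times_right coeff left_diff_distrib right_diff_distrib mult.assoc)
  show "B a (b * c) = B a b * c + b * B a c"
    by (rule fi_eqI)
      (simp add: coeff_times_left coeff_times_right coeff left_diff_distrib right_diff_distrib mult.assoc)
qed

lemma bilinear: "fi_bilinear B"
proof -
  have "B f (scale_fi r g) = scale_fi r (B f g)" "B (scale_fi r f) g = scale_fi r (B f g)" for r f g
    by (rule fi_eqI, simp add: coeff scale_fi_times_left scale_fi_times_right algebra_simps)+
  then show ?thesis
    using antisymmetric_biderivation module_scale_fi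
    unfolding fi_bilinear_def module_hom_iff antisymmetric_biderivation_def biderivation_def
    by simp
qed

end

theorem theorem3p10:
  shows "(\<forall>B :: ('p::order, 'r::comm_ring_1) fi \<Rightarrow> ('p, 'r) fi \<Rightarrow> ('p, 'r) fi.
      fi_bilinear B \<and> antisymmetric_biderivation B \<longleftrightarrow>
      (\<exists>\<sigma> :: 'p \<Rightarrow> 'p \<Rightarrow> 'r. constant_on_chains \<sigma> \<and>
        (\<forall>f g x y. x \<le> y \<longrightarrow>
          fi_coeff (B f g) x y = (if x = y then 0 else \<sigma> x y * fi_coeff (f * g - g * f) x y))))
    \<and> (\<forall>\<sigma> :: 'p \<Rightarrow> 'p \<Rightarrow> 'r. constant_on_chains \<sigma> \<longrightarrow>
        (\<forall>f g :: ('p, 'r) fi.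
          (\<lambda>x y. if x < y then \<sigma> x y * fi_coeff (f * g - g * f) x y else 0) \<in> finitary_series))"
proof (intro conjI allI impI iffI)
  fix B :: "('p, 'r) fi \<Rightarrow> ('p, 'r) fi \<Rightarrow> ('p, 'r) fi"
  assume "fi_bilinear B \<and> antisymmetric_biderivation B"
  then interpret fi_biderivation B by unfold_locales auto
  have "fi_coeff (B f g) x y = (if x = y then 0 else \<sigma> x y * fi_coeff (f * g - g * f) x y)"
    if "x \<le> y" for f g x y
    using that coeff_eq_\<sigma>_commutator by (simp add: right.coeff_diag)
  then show "\<exists>\<sigma>. constant_on_chains \<sigma> \<and> (\<forall>f g x y. x \<le> y \<longrightarrow>
      fi_coeff (B f g) x y = (if x = y then 0 else \<sigma> x y * fi_coeff (f * g - g * f) x y))"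
    using constant_on_chains_\<sigma> by blast
next
  fix B :: "('p, 'r) fi \<Rightarrow> ('p, 'r) fi \<Rightarrow> ('p, 'r) fi"
  assume "\<exists>\<sigma>. constant_on_chains \<sigma> \<and> (\<forall>f g x y. x \<le> y \<longrightarrow>
      fi_coeff (B f g) x y = (if x = y then 0 else \<sigma> x y * fi_coeff (f * g - g * f) x y))"
  then obtain \<sigma> where "chain_constant_bracket \<sigma> B"
    unfolding chain_constant_bracket_def by blast
  then interpret chain_constant_bracket \<sigma> B .
  show "fi_bilinear B" "antisymmetric_biderivation B"
    by (rule bilinear, rule antisymmetric_biderivation)
next
  fix \<sigma> :: "'p \<Rightarrow> 'p \<Rightarrow> 'r" and f g :: "('p, 'r) fi"
  show "(\<lambda>x y. if x < y then \<sigma> x y * fi_coeff (f * g - g * f) x y else 0) \<in> finitary_series"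
    \<comment> \<open>The support lies inside that of the commutator, which is finitary.\<close>
    by (rule finitary_series_pointwise[OF fi_coeff[of "f * g - g * f"] zero_finitary])
      (auto split: if_splits)
qed

end
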